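(* Let $0<\varepsilon<1/100$ and let $A=A_\varepsilon\subset\mathbb{R}^2$. Then $\tilde\Pi^A(x)=\infty$ for every $x$, i.e. $\prod_{n=0}^\infty(\cos\theta_n)^{-1}=\infty$ where $\theta_n$ is the common base angle of the level-$n$ caps in the construction of $A_\varepsilon$, and $A$ is not countably $1$-rectifiable.
   Context: A set $M\subset\mathbb{R}^2$ is countably $1$-rectifiable if $M\subset M_0\cup\bigcup_{j=1}^\infty F_j(\mathbb{R})$ with $\mathcal{H}^1(M_0)=0$ and $F_j:\mathbb{R}\to\mathbb{R}^2$ Lipschitz. Triangular caps: for a segment $S=[a,b]\subset\mathbb{R}^2$ and $h>0$, an $h$-triangular cap on $S$ is the closed solid isosceles triangle with base $S$ and third vertex $\frac{a+b}{2}+c$, where $|c|=h$ and $c\perp b-a$. If $S$ is an edge of a previously constructed cap $T$, the side is chosen so that the new cap is contained in $T$; on the initial segment $[(0,0),(1,0)]$ the third vertex has positive second coordinate. The base angle is either of the two equal angles at the base. Construction of $A_\varepsilon$: Let $A_0=A_{0,1}=[(0,0),(1,0)]$. Given $A_n=\bigcup_{i=1}^{2^n}A_{n,i}$, a polygonal curve from $(0,0)$ to $(1,0)$ whose segments are numbered consecutively from $(0,0)$ to $(1,0)$, let $T_{n,i}$ be the $2^{1-n}\varepsilon$-triangular cap on $A_{n,i}$, let $A_{n+1,2i-1},A_{n+1,2i}$ be the two edges of $T_{n,i}$ other than its base $A_{n,i}$, and let $A_{n+1}=\bigcup_{k=1}^{2^{n+1}}A_{n+1,k}$. Define $A_\varepsilon:=\overline{\bigcup_{n=1}^\infty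 A_n}\setminus\bigcup_{n=1}^\infty A_n$. All caps $T_{n,i}$ with the same $n$ have the same base angle $\theta_n$, and $\tilde\Pi^A(x):=\prod_{n=0}^\infty(\cos\theta_n)^{-1}$ for every $x$. *)

theory Defs
  imports "HOL-Analysis.Analysis"
begin

section \<open>Hausdorff measure and rectifiability\<close>

text \<open>
  The boundedness requirement is needed because \<^const>\<open>diameter\<close> has no meaningful value on
  unbounded sets. Finite covers are included, padding with the empty set, of diameter \<open>0\<close>.
\<close>

definition hausdorff1_pre :: "real \<Rightarrow> 'a::metric_space set \<Rightarrow> ennreal" where
  "hausdorff1_pre \<delta> E =
     (INF U \<in> {U :: nat \<Rightarrow> 'a set.
                 E \<subseteq> (\<Union>k. U k) \<and> (\<forall>k. bounded (U k) \<and> diameter (U k) \<le> \<delta>)}.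
        (\<Sum>k. ennreal (diameter (U k))))"

definition hausdorff1 :: "'a::metric_space set \<Rightarrow> ennreal" where
  "hausdorff1 E = (SUP \<delta> \<in> {0<..}. hausdorff1_pre \<delta> E)"

definition countably_1_rectifiable :: "'a::metric_space set \<Rightarrow> bool" where
  "countably_1_rectifiable M \<longleftrightarrow>
     (\<exists>M0 (F :: nat \<Rightarrow> real \<Rightarrow> 'a).
        hausdorff1 M0 = 0 \<and> (\<forall>j. \<exists>L. L-lipschitz_on UNIV (F j)) \<and>
        M \<subseteq> M0 \<union> (\<Union>j. range (F j)))"


section \<open>Triangular caps\<close>

text \<open>\<open>p\<close> is one of the two possible third vertices of an \<open>h\<close>-triangular cap on \<open>[a,b]\<close>.\<close>

definition is_apex :: "real \<Rightarrow> real^2 \<Rightarrow> real^2 \<Rightarrow> real^2 \<Rightarrow> bool" where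
  "is_apex h a b p \<longleftrightarrow>
     (\<exists>c. norm c = h \<and> orthogonal c (b - a) \<and> p = (1/2) *\<^sub>R (a + b) + c)"

definition triangle :: "real^2 \<Rightarrow> real^2 \<Rightarrow> real^2 \<Rightarrow> (real^2) set" where
  "triangle a b p = convex hull {a, b, p}"

definition vertex_angle :: "real^2 \<Rightarrow> real^2 \<Rightarrow> real^2 \<Rightarrow> real" where
  "vertex_angle v x y = arccos (((x - v) \<bullet> (y - v)) / (norm (x - v) * norm (y - v)))"


section \<open>The construction\<close>

definition first_apex :: "real \<Rightarrow> real^2 \<Rightarrow> real^2 \<Rightarrow> real^2" where
  "first_apex h a b = (THE p. is_apex h a b p \<and> p $ 2 > 0)"

definition inner_apex :: "(real^2) set \<Rightarrow> real \<Rightarrow> real^2 \<Rightarrow> real^2 \<Rightarrow> real^2" where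
  "inner_apex T h a b = (THE p. is_apex h a b p \<and> triangle a b p \<subseteq> T)"

definition cap_height :: "real \<Rightarrow> nat \<Rightarrow> real" where
  "cap_height \<epsilon> n = 2 powi (1 - int n) * \<epsilon>"

text \<open>
  For \<open>1 \<le> i \<le> 2 ^ n\<close>, the triple \<open>cap \<epsilon> n i = (a, b, p)\<close> encodes \<open>A\<^sub>n\<^sub>,\<^sub>i = [a,b]\<close>, with \<open>a\<close> preceding
  \<open>b\<close> on the curve, together with the third vertex \<open>p\<close> of \<open>T\<^sub>n\<^sub>,\<^sub>i\<close>. The segment \<open>A\<^sub>n\<^sub>+\<^sub>1\<^sub>,\<^sub>i\<close> is an
  edge of \<open>T\<^sub>n\<^sub>,\<^sub>k\<close> with \<open>k = (i + 1) div 2\<close>, that is \<open>i = 2k - 1\<close> or \<open>i = 2k\<close>.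
\<close>

fun cap :: "real \<Rightarrow> nat \<Rightarrow> nat \<Rightarrow> (real^2) \<times> (real^2) \<times> (real^2)" where
  "cap \<epsilon> 0 i =
     (let a = vector [0, 0]; b = vector [1, 0] in (a, b, first_apex (cap_height \<epsilon> 0) a b))"
| "cap \<epsilon> (Suc n) i =
     (case cap \<epsilon> n ((i + 1) div 2) of (a, b, p) \<Rightarrow>
        (let (a', b') = (if odd i then (a, p) else (p, b))
         in (a', b', inner_apex (triangle a b p) (cap_height \<epsilon> (Suc n)) a' b')))"

definition edge :: "real \<Rightarrow> nat \<Rightarrow> nat \<Rightarrow> (real^2) set" where
  "edge \<epsilon> n i = (case cap \<epsilon> n i of (a, b, p) \<Rightarrow> closed_segment a b)"

definition curve :: "real \<Rightarrow> nat \<Rightarrow> (real^2) set" where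
  "curve \<epsilon> n = (\<Union>i\<in>{1..2 ^ n}. edge \<epsilon> n i)"

definition A_set :: "real \<Rightarrow> (real^2) set" where
  "A_set \<epsilon> = closure (\<Union>n\<in>{1..}. curve \<epsilon> n) - (\<Union>n\<in>{1..}. curve \<epsilon> n)"

definition base_angle :: "real \<Rightarrow> nat \<Rightarrow> real" where
  "base_angle \<epsilon> n =
     (THE t. \<forall>i\<in>{1..2 ^ n}. case cap \<epsilon> n i of (a, b, p) \<Rightarrow>
               vertex_angle a b p = t \<and> vertex_angle b a p = t)"

text \<open>The product is taken in the extended reals, since it may diverge; it does not depend on \<open>x\<close>.\<close>

definition Pi_tilde :: "real \<Rightarrow> real^2 \<Rightarrow> ereal" where
  "Pi_tilde \<epsilon> x = lim (\<lambda>N. ereal (\<Prod>n<N. inverse (cos (base_angle \<epsilon> n))))"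

end

theory Submission
  imports Defs
begin

text \<open>
  By Pythagoras the edges of level \<open>n\<close> have length \<open>2\<^sup>-\<^sup>n m\<^sub>n\<close> with \<open>m\<^sub>n = sqrt (1 + 16 \<epsilon>\<^sup>2 n)\<close>, so
  \<open>cos \<theta>\<^sub>n = m\<^sub>n / m\<^sub>n\<^sub>+\<^sub>1\<close> and the product telescopes to \<open>m\<^sub>N\<close>, which tends to infinity.

  For non-rectifiability, parametrize the limit curve by \<open>\<gamma>\<close> on \<open>[0,1)\<close>, sending the dyadic intervals of
  level \<open>n\<close> into the caps of level \<open>n\<close>. The two caps on the legs of a cap meet at an obtuse angle,
  so points whose parameters differ by at least \<open>2 / 2\<^sup>n\<close> are at distance at least half an edge of
  level \<open>n\<close>. As \<open>m\<^sub>n\<close> is unbounded, \<open>\<bar>s - t\<bar>\<close> is \<open>o(dist (\<gamma> s) (\<gamma> t))\<close>. Hence preimages under \<open>\<gamma>\<close> of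
  Lipschitz images of the line and of null sets of the one-dimensional Hausdorff measure are
  Lebesgue null. The edges of the polygonal curves are Lipschitz images, so if \<open>A\<close> were rectifiable
  then \<open>[0,1)\<close> would be a null set.
\<close>

section \<open>Plane geometry of isosceles triangles\<close>

definition rot :: "real^2 \<Rightarrow> real^2" where
  "rot x = vector [- x $ 2, x $ 1]"

lemma rot_nth [simp]: "rot x $ 1 = - x $ 2" "rot x $ 2 = x $ 1"
  by (simp_all add: rot_def)

lemma inner_vec2: "(x::real^2) \<bullet> y = x $ 1 * y $ 1 + x $ 2 * y $ 2"
  by (simp add: inner_vec_def sum_2)

lemma vec2_eq_iff: "(x::real^2) = y \<longleftrightarrow> x $ 1 = y $ 1 \<and> x $ 2 = y $ 2"
  by (simp add: vec_eq_iff forall_2)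

lemma norm_rot [simp]: "norm (rot x) = norm x"
  by (simp add: norm_eq_sqrt_inner inner_vec2 add.commute)

lemma inner_rot [simp]: "x \<bullet> rot x = 0" "rot x \<bullet> x = 0"
  by (simp_all add: inner_vec2)

text \<open>\<open>rot\<close> is the quarter turn, and in the plane the orthogonal complement of a
  nonzero \<open>d\<close> is the line spanned by \<open>rot d\<close>. The coefficient is that of
  the projection.\<close>

lemma orthogonal_imp_rot:
  assumes "orthogonal c d" "d \<noteq> 0"
  obtains s where "c = s *\<^sub>R rot d"
proof
  have o: "c $ 1 * d $ 1 + c $ 2 * d $ 2 = 0"
    using assms by (simp add: orthogonal_def inner_vec2)
  have n: "d \<bullet> d \<noteq> 0" using assms by simp
  have "(d \<bullet> d) * c $ 1 = (c \<bullet> rot d) * (- d $ 2)" "(d \<bullet> d) * c $ 2 = (c \<bullet> rot d) * d $ 1"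
    using o by (simp_all add: inner_vec2, algebra+)
  then show "c = ((c \<bullet> rot d) / (d \<bullet> d)) *\<^sub>R rot d"
    using n by (simp add: vec2_eq_iff divide_simps mult.commute)
qed

lemma is_apex_iff:
  assumes "a \<noteq> b" "0 \<le> h"
  shows "is_apex h a b p \<longleftrightarrow>
    (\<exists>s\<in>{1, -1}. p = (1/2) *\<^sub>R (a + b) + (s * (h / norm (b - a))) *\<^sub>R rot (b - a))"
proof
  assume "is_apex h a b p"
  then obtain c where c: "norm c = h" "orthogonal c (b - a)" "p = (1/2) *\<^sub>R (a + b) + c"
    by (auto simp: is_apex_def)
  obtain s where s: "c = s *\<^sub>R rot (b - a)"
    using orthogonal_imp_rot[OF c(2)] assms by auto
  have "\<bar>s\<bar> = h / norm (b - a)"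
    using c(1) s assms by (auto simp: field_simps)
  then have "s = 1 * (h / norm (b - a)) \<or> s = (-1) * (h / norm (b - a))" by linarith
  then show "\<exists>s\<in>{1, -1}. p = (1/2) *\<^sub>R (a + b) + (s * (h / norm (b - a))) *\<^sub>R rot (b - a)"
    using c(3) s by blast
next
  assume "\<exists>s\<in>{1, -1}. p = (1/2) *\<^sub>R (a + b) + (s * (h / norm (b - a))) *\<^sub>R rot (b - a)"
  then show "is_apex h a b p"
    using assms unfolding is_apex_def by (auto simp: orthogonal_def)
qed

lemma triangleI:
  assumes "0 \<le> \<alpha>" "0 \<le> \<beta>" "0 \<le> \<kappa>" "\<alpha> + \<beta> + \<kappa> = 1" "x = \<alpha> *\<^sub>R a + \<beta> *\<^sub>R b + \<kappa> *\<^sub>R p"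
  shows "x \<in> triangle a b p"
  using assms unfolding triangle_def convex_hull_3 by blast

lemma triangle_subset_iff:
  "convex S \<Longrightarrow> triangle a b p \<subseteq> S \<longleftrightarrow> a \<in> S \<and> b \<in> S \<and> p \<in> S"
  unfolding triangle_def by (metis empty_subsetI insert_subset subset_hull)

lemma vertices_in_triangle: "a \<in> triangle a b p" "b \<in> triangle a b p" "p \<in> triangle a b p"
  unfolding triangle_def by (auto intro: hull_inc)

lemma convex_triangle: "convex (triangle a b p)"
  by (simp add: triangle_def)

lemma compact_triangle: "compact (triangle a b p)"
  by (simp add: triangle_def finite_imp_compact_convex_hull)

text \<open>A linear function on a triangle is largest at a vertex, so such a bound on a whole cap
  reduces to three points.\<close>

lemma triangle_inner_le:
  assumes "x \<in> triangle a b p" "(a - c) \<bullet> w \<le> k" "(b - c) \<bullet> w \<le> k" "(p - c) \<bullet> w \<le> k"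
  shows "(x - c) \<bullet> w \<le> k"
proof -
  have "convex {x. w \<bullet> x \<le> k + c \<bullet> w}" by (rule convex_halfspace_le)
  then have "triangle a b p \<subseteq> {x. w \<bullet> x \<le> k + c \<bullet> w}"
    using assms(2-4) by (subst triangle_subset_iff) (auto simp: inner_diff_left inner_diff_right inner_commute)
  then show ?thesis using assms(1) by (auto simp: inner_diff_left inner_diff_right inner_commute)
qed

text \<open>\<open>\<tau>\<close> is the height divided by the base length, signed: positive values
  put the apex on the left when going from \<open>a\<close> to \<open>b\<close>. Inner products of
  cap vertices become polynomials in such ratios times the squared base length.\<close>

definition apex :: "real \<Rightarrow> real^2 \<Rightarrow> real^2 \<Rightarrow> real^2" where
  "apex \<tau> a b = (1/2) *\<^sub>R (a + b) + \<tau> *\<^sub>R rot (b - a)"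

lemma apex_nth: 
  "apex \<tau> a b $ 1 = (a $ 1 + b $ 1) / 2 - \<tau> * (b $ 2 - a $ 2)"
  "apex \<tau> a b $ 2 = (a $ 2 + b $ 2) / 2 + \<tau> * (b $ 1 - a $ 1)"
  by (simp_all add: apex_def algebra_simps)

lemma norm_apex_diff:
  "norm (apex \<tau> a b - a) = sqrt (1/4 + \<tau>\<^sup>2) * norm (b - a)"
  "norm (b - apex \<tau> a b) = sqrt (1/4 + \<tau>\<^sup>2) * norm (b - a)"
  by (simp_all add: norm_eq_sqrt_inner inner_vec2 apex_nth flip: real_sqrt_mult,
      simp_all add: field_simps power2_eq_square)

text \<open>An apex erected on a leg towards the base has explicit barycentric coordinates in the
  parent triangle, and these are nonnegative.\<close>

lemma child_apex_in_triangle: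
  fixes a b :: "real^2"
  assumes "0 < \<tau>'" "\<tau>' \<le> \<tau>" "\<tau> \<le> 1/2" "\<sigma> \<in> {1, -1}"
  defines "p \<equiv> apex (\<sigma> * \<tau>) a b"
  shows "apex (- \<sigma> * \<tau>') a p \<in> triangle a b p" "apex (- \<sigma> * \<tau>') p b \<in> triangle a b p"
proof -
  \<comment> \<open>\<open>w\<close> is the weight of \<open>p\<close>, and \<open>w'\<close> that
    of the base vertex not on the leg; \<open>\<tau>' \<le> \<tau>\<close> makes \<open>w\<close>
    nonnegative.\<close>
  define w where "w = (1 - \<tau>' / \<tau>) / 2"
  define w' where "w' = \<tau>' / (4 * \<tau>) + \<tau> * \<tau>'"
  have t: "\<tau> > 0" using assms by linarith
  have w: "0 \<le> w" using assms t by (simp add: w_def)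
  have w': "0 \<le> w'" using assms t by (simp add: w'_def)
  have "\<tau> * \<tau>' \<le> (1/2) * (1/2)" using assms by (intro mult_mono) auto
  moreover have "1 - w - w' = 1/2 + \<tau>' / (4 * \<tau>) - \<tau> * \<tau>'"
    by (simp add: w_def w'_def field_simps)
  moreover have "\<tau>' / (4 * \<tau>) \<ge> 0" using assms t by simp
  ultimately have w'': "0 \<le> 1 - w - w'" by linarith
  have s: "\<sigma> * \<sigma> = 1" using assms by auto
  \<comment> \<open>Relations free of division by \<open>\<tau>\<close>, as input for
    \<open>algebra\<close>.\<close>
  have ew: "2 * \<tau> * w = \<tau> - \<tau>'" using t by (simp add: w_def field_simps)
  have ew': "4 * \<tau> * w' = \<tau>' + 4 * \<tau> * \<tau> * \<tau>'" using t by (simp add: w'_def field_simps)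
  have e: "w / 2 + w' = 1/4 + \<tau> * \<tau>'" using t by (simp add: w_def w'_def field_simps)
  show "apex (- \<sigma> * \<tau>') a p \<in> triangle a b p"
  proof (rule triangleI[OF w'' w' w])
    show "apex (- \<sigma> * \<tau>') a p = (1 - w - w') *\<^sub>R a + w' *\<^sub>R b + w *\<^sub>R p"
      unfolding vec2_eq_iff p_def using s ew e by (simp add: apex_nth field_simps) (intro conjI; algebra)
  qed simp
  show "apex (- \<sigma> * \<tau>') p b \<in> triangle a b p"
  proof (rule triangleI[OF w' w'' w])
    show "apex (- \<sigma> * \<tau>') p b = w' *\<^sub>R a + (1 - w - w') *\<^sub>R b + w *\<^sub>R p"
      unfolding vec2_eq_iff p_def using s ew e by (simp add: apex_nth field_simps) (intro conjI; algebra)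
  qed simp
qed

text \<open>The line through the leg separates: along the outward normal of the leg the candidate
  apex has positive height, while no vertex of the triangle does.\<close>

lemma outer_apex_notin_triangle:
  fixes a b :: "real^2"
  assumes "0 < \<tau>'" "0 < \<tau>" "\<sigma> \<in> {1, -1}" "a \<noteq> b"
  defines "p \<equiv> apex (\<sigma> * \<tau>) a b"
  shows "apex (\<sigma> * \<tau>') a p \<notin> triangle a b p" "apex (\<sigma> * \<tau>') p b \<notin> triangle a b p"
proof -
  have s: "\<sigma> * \<sigma> = 1" using assms by auto
  define N where "N = (b - a) \<bullet> (b - a)"
  have N: "N > 0" using assms by (simp add: N_def)
  have e: "(apex (\<sigma> * \<tau>') a p - a) \<bullet> (\<sigma> *\<^sub>R rot (p - a)) = \<tau>' * (1/4 + \<tau>\<^sup>2) * N"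
     "(apex (\<sigma> * \<tau>') p b - b) \<bullet> (\<sigma> *\<^sub>R rot (b - p)) = \<tau>' * (1/4 + \<tau>\<^sup>2) * N"
    unfolding p_def N_def using s by (simp_all add: inner_vec2 apex_nth field_simps power2_eq_square; algebra)+
  have pos: "\<tau>' * (1/4 + \<tau>\<^sup>2) * N > 0"
    using assms N by (intro mult_pos_pos) (auto intro: add_pos_nonneg)
  have f: "(b - a) \<bullet> (\<sigma> *\<^sub>R rot (p - a)) = - \<tau> * N"  "(a - b) \<bullet> (\<sigma> *\<^sub>R rot (b - p)) = - \<tau> * N"
    unfolding p_def N_def using s by (simp_all add: inner_vec2 apex_nth field_simps; algebra)+
  have le: "- \<tau> * N \<le> 0" using assms N by simp
  have g: "(p - b) \<bullet> rot (b - p) = 0" by (simp add: inner_vec2 algebra_simps)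
  show "apex (\<sigma> * \<tau>') a p \<notin> triangle a b p"
  proof
    assume "apex (\<sigma> * \<tau>') a p \<in> triangle a b p"
    from triangle_inner_le[OF this, of a "\<sigma> *\<^sub>R rot (p - a)" 0] show False
      using e f le pos by simp
  qed
  show "apex (\<sigma> * \<tau>') p b \<notin> triangle a b p"
  proof
    assume "apex (\<sigma> * \<tau>') p b \<in> triangle a b p"
    from triangle_inner_le[OF this, of b "\<sigma> *\<^sub>R rot (b - p)" 0] show False
      using e f g le pos by simp
  qed
qed

section \<open>Metric estimates for the two child caps\<close>

text \<open>Projected to the base, the vertices of the left child sit at the fractions 0, 1/2 and
  1/4 + \<open>\<tau> * \<tau>'\<close>, so the child stays over the left half. Cauchy-Schwarz turns
  the remaining gap to \<open>b\<close> into a distance.\<close>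

lemma dist_left_child:
  fixes a b :: "real^2"
  assumes "\<sigma> \<in> {1, -1}" "0 \<le> \<tau>" "\<tau> \<le> 1/4" "0 \<le> \<tau>'" "\<tau>' \<le> 1/4"
  defines "p \<equiv> apex (\<sigma> * \<tau>) a b"
  assumes x: "x \<in> triangle a p (apex (- \<sigma> * \<tau>') a p)"
  shows "norm (b - a) / 2 \<le> dist x b"
proof -
  define N where "N = (b - a) \<bullet> (b - a)"
  have s: "\<sigma> * \<sigma> = 1" using assms by auto
  have N: "N \<ge> 0" by (simp add: N_def)
  have "\<tau> * \<tau>' \<le> (1/4) * (1/4)" using assms by (intro mult_mono) auto
  then have "(1/4 + \<tau> * \<tau>') * N \<le> (1/2) * N" using N by (intro mult_right_mono) auto
  moreover have "(apex (- \<sigma> * \<tau>') a p - b) \<bullet> (b - a) = (1/4 + \<tau> * \<tau>') * N - N"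
    unfolding p_def N_def using s by (simp add: inner_vec2 apex_nth field_simps) algebra
  moreover have "(a - b) \<bullet> (b - a) = - N"
    by (simp add: N_def algebra_simps)
  moreover have "(p - b) \<bullet> (b - a) = - N / 2"
    unfolding p_def N_def by (simp add: inner_vec2 apex_nth field_simps)
  ultimately have "(x - b) \<bullet> (b - a) \<le> - N / 2"
    using N by (intro triangle_inner_le[OF x]) auto
  then have "N / 2 \<le> (b - x) \<bullet> (b - a)" by (simp add: inner_diff_left)
  also have "\<dots> \<le> norm (b - x) * norm (b - a)" by (rule norm_cauchy_schwarz)
  finally have "norm (b - a) * norm (b - a) / 2 \<le> norm (b - x) * norm (b - a)"
    by (simp add: N_def flip: power2_norm_eq_inner) (simp add: power2_eq_square)
  then show ?thesis
    by (cases "a = b") (auto simp: dist_norm norm_minus_commute)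
qed

lemma apex_commute: "apex \<tau> a b = apex (- \<tau>) b a"
  by (simp add: vec2_eq_iff apex_nth algebra_simps)

lemma triangle_commute: "triangle a b p = triangle b a p"
  by (simp add: triangle_def insert_commute)

lemma dist_right_child:
  fixes a b :: "real^2"
  assumes "\<sigma> \<in> {1, -1}" "0 \<le> \<tau>" "\<tau> \<le> 1/4" "0 \<le> \<tau>'" "\<tau>' \<le> 1/4"
  defines "p \<equiv> apex (\<sigma> * \<tau>) a b"
  assumes x: "x \<in> triangle p b (apex (- \<sigma> * \<tau>') p b)"
  shows "norm (b - a) / 2 \<le> dist x a"
proof -
  have "norm (a - b) / 2 \<le> dist x a"
  \<comment> \<open>Reversing the base exchanges the two children and flips the sign of the
    apex.\<close>
  proof (rule dist_left_child[of "-\<sigma>" \<tau> \<tau>'])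
    show "x \<in> triangle b (apex (- \<sigma> * \<tau>) b a) (apex (- (- \<sigma>) * \<tau>') b (apex (- \<sigma> * \<tau>) b a))"
      using x unfolding p_def
      by (metis apex_commute triangle_commute minus_mult_left minus_minus)
  qed (use assms in auto)
  then show ?thesis by (simp add: norm_minus_commute)
qed

text \<open>This is the obtuse angle at \<open>p\<close>. The expression is affine in
  \<open>x\<close> and in \<open>y\<close> separately, so vertices suffice; the vertex
  \<open>p\<close> contributes 0, and four products remain.\<close>

lemma inner_children_le_0:
  fixes a b :: "real^2"
  assumes "\<sigma> \<in> {1, -1}" "0 \<le> \<tau>" "\<tau> \<le> 1/8" "0 \<le> \<tau>'" "\<tau>' \<le> 1/8"
  defines "p \<equiv> apex (\<sigma> * \<tau>) a b"
  assumes x: "x \<in> triangle a p (apex (- \<sigma> * \<tau>') a p)"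
    and y: "y \<in> triangle p b (apex (- \<sigma> * \<tau>') p b)"
  shows "(x - p) \<bullet> (y - p) \<le> 0"
proof -
  define N where "N = (b - a) \<bullet> (b - a)"
  define q where "q = apex (- \<sigma> * \<tau>') a p"
  define r where "r = apex (- \<sigma> * \<tau>') p b"
  have s: "\<sigma> * \<sigma> = 1" using assms by auto
  have N: "N \<ge> 0" by (simp add: N_def)
  have m: "\<tau> * \<tau>' \<le> (1/8) * (1/8)" "\<tau> * \<tau> \<le> (1/8) * (1/8)" "\<tau>' * \<tau>' \<le> (1/8) * (1/8)"
     "0 \<le> \<tau> * \<tau>'"
    using assms by (intro mult_mono mult_nonneg_nonneg; simp)+
  have 1: "(a - p) \<bullet> (b - p) = (\<tau> * \<tau> - 1/4) * N"
    unfolding p_def N_def using s by (simp add: inner_vec2 apex_nth field_simps) algebra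
  have 2: "(a - p) \<bullet> (r - p) = (- 1/8 + \<tau> * \<tau>' + \<tau> * \<tau> / 2) * N"
    unfolding r_def p_def N_def using s by (simp add: inner_vec2 apex_nth field_simps) algebra
  have 3: "(q - p) \<bullet> (b - p) = (- 1/8 + \<tau> * \<tau>' + \<tau> * \<tau> / 2) * N"
    unfolding q_def p_def N_def using s by (simp add: inner_vec2 apex_nth field_simps) algebra
  have 4: "(q - p) \<bullet> (r - p) = ((\<tau> + \<tau>')\<^sup>2 / 4 - (1/4 - \<tau> * \<tau>')\<^sup>2) * N"
    unfolding q_def r_def p_def N_def using s by (simp add: inner_vec2 apex_nth field_simps power2_eq_square) algebra
  \<comment> \<open>For the product of the two new apexes, ratios up to 1/8 bound the first term by
    1/64 from above and the subtracted square by 1/64 from below.\<close>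
  have "(\<tau> + \<tau>')\<^sup>2 \<le> (1/4)\<^sup>2" using assms by (intro power_mono) auto
  moreover have "(1/8)\<^sup>2 \<le> (1/4 - \<tau> * \<tau>')\<^sup>2" using m by (intro power_mono) auto
  ultimately have 5: "(\<tau> + \<tau>')\<^sup>2 / 4 - (1/4 - \<tau> * \<tau>')\<^sup>2 \<le> 0" by (simp add: power2_eq_square)
  have *: "(x - p) \<bullet> w \<le> 0" if "(a - p) \<bullet> w \<le> 0" "(q - p) \<bullet> w \<le> 0" for w
    using that by (intro triangle_inner_le[OF x]) (auto simp: q_def)
  have "(y - p) \<bullet> (x - p) \<le> 0"
  proof (rule triangle_inner_le[OF y])
    have "(x - p) \<bullet> (b - p) \<le> 0" 
      using 1 3 m N by (intro *) (auto intro: mult_nonpos_nonneg)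
    then show "(b - p) \<bullet> (x - p) \<le> 0" by (simp add: inner_commute)
    have "(x - p) \<bullet> (r - p) \<le> 0" 
      using 2 4 5 m N by (intro *) (auto intro: mult_nonpos_nonneg)
    then show "(apex (- \<sigma> * \<tau>') p b - p) \<bullet> (x - p) \<le> 0" by (simp add: inner_commute r_def)
  qed simp
  then show ?thesis by (simp add: inner_commute)
qed

text \<open>By the law of cosines, the side facing a non-acute angle is the longest. Points in
  different children can thus be compared with the common vertex \<open>p\<close>.\<close>

lemma dist_children:
  fixes a b :: "real^2"
  assumes "\<sigma> \<in> {1, -1}" "0 \<le> \<tau>" "\<tau> \<le> 1/8" "0 \<le> \<tau>'" "\<tau>' \<le> 1/8"
  defines "p \<equiv> apex (\<sigma> * \<tau>) a b"
  assumes x: "x \<in> triangle a p (apex (- \<sigma> * \<tau>') a p)"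
    and y: "y \<in> triangle p b (apex (- \<sigma> * \<tau>') p b)"
  shows "dist x p \<le> dist x y" "dist y p \<le> dist x y"
proof -
  have "(x - p) \<bullet> (y - p) \<le> 0"
    using inner_children_le_0[OF assms(1-5)] x y unfolding p_def by blast
  moreover have "(dist x y)\<^sup>2 = (dist x p)\<^sup>2 + (dist y p)\<^sup>2 - 2 * ((x - p) \<bullet> (y - p))"
    by (simp add: dist_norm power2_norm_eq_inner inner_diff_left inner_diff_right inner_commute)
  ultimately have "(dist x p)\<^sup>2 \<le> (dist x y)\<^sup>2" "(dist y p)\<^sup>2 \<le> (dist x y)\<^sup>2"
    by (smt (verit) zero_le_power2)+
  then show "dist x p \<le> dist x y" "dist y p \<le> dist x y"
    by (auto dest: power2_le_imp_le)
qed


section \<open>The apexes selected by the construction\<close>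

lemma is_apex_iff_apex:
  assumes "a \<noteq> b" "0 \<le> \<tau>" "\<sigma> \<in> {1, -1}"
  shows "is_apex (\<tau> * norm (b - a)) a b p \<longleftrightarrow> p = apex (\<sigma> * \<tau>) a b \<or> p = apex (- \<sigma> * \<tau>) a b"
proof -
  have "norm (b - a) \<noteq> 0" using assms by simp
  then have "\<tau> * norm (b - a) / norm (b - a) = \<tau>" by simp
  then show ?thesis
    using assms by (subst is_apex_iff) (auto simp: apex_def)
qed

text \<open>The base has length 1, so height and ratio coincide, and the two candidates have second
  coordinates \<open>h\<close> and \<open>- h\<close>.\<close>

lemma first_apex_eq:
  assumes "0 < h"
  shows "first_apex h (vector [0, 0]) (vector [1, 0]) = apex h (vector [0, 0]) (vector [1, 0])"
proof -
  let ?a = "vector [0, 0] :: real^2" and ?b = "vector [1, 0] :: real^2"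
  have ne: "?a \<noteq> ?b" by (simp add: vec2_eq_iff)
  have n: "norm (?b - ?a) = 1" by (simp add: norm_eq_sqrt_inner inner_vec2)
  have *: "is_apex h ?a ?b p \<longleftrightarrow> p = apex h ?a ?b \<or> p = apex (- h) ?a ?b" for p
    using is_apex_iff_apex[OF ne, of h 1 p] assms n by simp
  show ?thesis
    unfolding first_apex_def * by (rule the_equality) (use assms in \<open>auto simp: apex_nth\<close>)
qed

text \<open>Of the two candidates on a leg, the one with the sign opposite to the parent's lies
  inside the parent and the other outside. So \<open>THE\<close> is well defined, and the sign
  changes from each level to the next.\<close>

lemma inner_apex_eq:
  fixes a b :: "real^2"
  assumes "0 < \<tau>'" "\<tau>' \<le> \<tau>" "\<tau> \<le> 1/2" "\<sigma> \<in> {1, -1}" "a \<noteq> b"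
  defines "p \<equiv> apex (\<sigma> * \<tau>) a b"
  shows "inner_apex (triangle a b p) (\<tau>' * norm (p - a)) a p = apex (- \<sigma> * \<tau>') a p"
    "inner_apex (triangle a b p) (\<tau>' * norm (b - p)) p b = apex (- \<sigma> * \<tau>') p b"
proof -
  have t: "0 < \<tau>" "0 \<le> \<tau>'" using assms by auto
  have "sqrt (1/4 + (\<sigma> * \<tau>)\<^sup>2) > 0" by (simp add: add_pos_nonneg)
  then have "norm (p - a) > 0" "norm (b - p) > 0"
    unfolding p_def norm_apex_diff using assms by auto
  then have ne: "a \<noteq> p" "p \<noteq> b" by auto
  note in_tr = child_apex_in_triangle[OF assms(1-4), of a b, folded p_def]
  note out_tr = outer_apex_notin_triangle[OF assms(1) t(1) assms(4,5), folded p_def]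
  show "inner_apex (triangle a b p) (\<tau>' * norm (p - a)) a p = apex (- \<sigma> * \<tau>') a p"
    unfolding inner_apex_def
    by (rule the_equality, unfold is_apex_iff_apex[OF ne(1) t(2) assms(4)])
      (use in_tr out_tr in \<open>auto simp: triangle_subset_iff convex_triangle vertices_in_triangle\<close>)
  show "inner_apex (triangle a b p) (\<tau>' * norm (b - p)) p b = apex (- \<sigma> * \<tau>') p b"
    unfolding inner_apex_def
    by (rule the_equality, unfold is_apex_iff_apex[OF ne(2) t(2) assms(4)])
      (use in_tr out_tr in \<open>auto simp: triangle_subset_iff convex_triangle vertices_in_triangle\<close>)
qed

text \<open>The legs are no longer than the base, so the disc about \<open>a\<close> through
  \<open>b\<close> contains all three vertices.\<close>

lemma dist_triangle_vertex_le:
  assumes "\<bar>\<tau>\<bar> \<le> 1/2" "x \<in> triangle a b (apex \<tau> a b)"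
  shows "dist x a \<le> norm (b - a)"
proof -
  have "\<tau>\<^sup>2 \<le> (1/2)\<^sup>2" using assms(1) by (subst abs_le_square_iff[symmetric]) simp
  then have "sqrt (1/4 + \<tau>\<^sup>2) \<le> 1" by (simp add: power2_eq_square)
  then have "norm (apex \<tau> a b - a) \<le> norm (b - a)"
    unfolding norm_apex_diff by (intro mult_left_le_one_le) auto
  then have "triangle a b (apex \<tau> a b) \<subseteq> cball a (norm (b - a))"
    by (subst triangle_subset_iff) (auto simp: dist_norm norm_minus_commute)
  then show ?thesis using assms(2) by (auto simp: dist_commute)
qed

text \<open>The apex projects to the midpoint of the base, so the cosine is half the base over a
  leg.\<close>

lemma vertex_angle_apex:
  fixes \<tau> :: real
  assumes "a \<noteq> b"
  defines "p \<equiv> apex \<tau> a b"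
  shows "vertex_angle a b p = arccos (norm (b - a) / (2 * norm (p - a)))"
    "vertex_angle b a p = arccos (norm (b - a) / (2 * norm (p - a)))"
proof -
  have n: "norm (b - p) = norm (p - a)" by (simp add: p_def norm_apex_diff)
  have "(b - a) \<bullet> (p - a) = (norm (b - a))\<^sup>2 / 2" "(a - b) \<bullet> (p - b) = (norm (b - a))\<^sup>2 / 2"
    unfolding power2_norm_eq_inner p_def by (simp_all add: inner_vec2 apex_nth field_simps)
  moreover have "x\<^sup>2 / 2 / (x * y) = x / (2 * y)" if "x \<noteq> 0" for x y :: real
    using that by (simp add: power2_eq_square)
  moreover have "norm (b - a) \<noteq> 0" using assms(1) by simp
  ultimately show "vertex_angle a b p = arccos (norm (b - a) / (2 * norm (p - a)))"
    "vertex_angle b a p = arccos (norm (b - a) / (2 * norm (p - a)))"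
    unfolding vertex_angle_def norm_minus_commute[of a b] norm_minus_commute[of p b] n by metis+
qed

section \<open>Steep maps and rectifiable sets\<close>

text \<open>A set of diameter at most \<open>d k\<close> lies in an interval of length
  \<open>2 * d k\<close>; the factor 2 is absorbed by applying the hypothesis to
  \<open>e / 2\<close>.\<close>

lemma negligible_if_small_covers:
  fixes E :: "real set"
  assumes "\<And>e. e > 0 \<Longrightarrow> \<exists>(V :: nat \<Rightarrow> real set) d. E \<subseteq> (\<Union>k. V k) \<and> (\<forall>k. 0 \<le> d k) \<and>
     (\<forall>k. \<forall>s\<in>V k. \<forall>t\<in>V k. \<bar>s - t\<bar> \<le> d k) \<and> (\<Sum>k. ennreal (d k)) \<le> ennreal e"
  shows "negligible E"
  unfolding negligible_outer_le
proof (intro allI impI)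
  fix e :: real assume "e > 0"
  then obtain V :: "nat \<Rightarrow> real set" and d where V: "E \<subseteq> (\<Union>k. V k)" and d: "\<And>k. 0 \<le> d k"
    and Vd: "\<And>k s t. s \<in> V k \<Longrightarrow> t \<in> V k \<Longrightarrow> \<bar>s - t\<bar> \<le> d k"
    and sum: "(\<Sum>k. ennreal (d k)) \<le> ennreal (e / 2)"
    using assms[of "e / 2"] by (metis half_gt_zero)
  \<comment> \<open>For empty \<open>V k\<close> the centre is an unspecified real; the inclusion is
    then trivial and the length of the interval is counted all the same.\<close>
  define I where "I k = {(SOME x. x \<in> V k) - d k .. (SOME x. x \<in> V k) + d k}" for k
  have VI: "V k \<subseteq> I k" for k
  proof
    fix x assume x: "x \<in> V k"
    then have "(SOME x. x \<in> V k) \<in> V k" by (rule someI)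
    from Vd[OF x this] show "x \<in> I k" by (auto simp: I_def)
  qed
  have "emeasure lebesgue (\<Union>k. I k) \<le> (\<Sum>k. emeasure lebesgue (I k))"
    by (rule emeasure_subadditive_countably) (auto simp: I_def)
  also have "\<dots> = (\<Sum>k. 2 * ennreal (d k))"
    using d by (simp add: I_def ennreal_mult' flip: ennreal_numeral)
  also have "\<dots> = 2 * (\<Sum>k. ennreal (d k))" by simp
  also have "\<dots> \<le> 2 * ennreal (e / 2)" by (intro mult_left_mono sum) auto
  also have "\<dots> = ennreal e" using \<open>e > 0\<close> by (simp flip: ennreal_numeral ennreal_mult')
  finally have le: "emeasure lebesgue (\<Union>k. I k) \<le> ennreal e" .
  show "\<exists>T. E \<subseteq> T \<and> T \<in> lmeasurable \<and> measure lebesgue T \<le> e"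
  proof (intro exI conjI)
    show "E \<subseteq> (\<Union>k. I k)" using V VI by blast
    show "(\<Union>k. I k) \<in> lmeasurable"
      using le by (intro fmeasurableI) (auto simp: I_def order_le_less_trans)
    show "measure lebesgue (\<Union>k. I k) \<le> e"
      using le \<open>e > 0\<close> by (auto simp: measure_def intro: enn2real_leI)
  qed
qed

text \<open>A cover of \<open>M\<close> pulls back to a cover of the preimage whose diameters are
  larger by a factor of at most \<open>C\<close>.\<close>

lemma negligible_vimage_hausdorff1_null:
  fixes \<gamma> :: "real \<Rightarrow> 'a::metric_space"
  assumes null: "hausdorff1 M = 0"
    and C: "\<And>s t. s \<in> S \<Longrightarrow> t \<in> S \<Longrightarrow> \<bar>s - t\<bar> \<le> C * dist (\<gamma> s) (\<gamma> t)" and "C > 0"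
  shows "negligible {t \<in> S. \<gamma> t \<in> M}"
proof (rule negligible_if_small_covers)
  fix e :: real assume "e > 0"
  \<comment> \<open>The scale 1 is arbitrary: only the total diameter of a cover matters
    here.\<close>
  have "hausdorff1_pre 1 M = 0"
    using null unfolding hausdorff1_def by (auto simp: SUP_eq_iff dest: spec bspec)
  then have "hausdorff1_pre 1 M < ennreal (e / C)" using \<open>e > 0\<close> \<open>C > 0\<close> by simp
  then obtain U :: "nat \<Rightarrow> 'a set" where U: "M \<subseteq> (\<Union>k. U k)" "\<And>k. bounded (U k)"
    and sum: "(\<Sum>k. ennreal (diameter (U k))) < ennreal (e / C)"
    unfolding hausdorff1_pre_def INF_less_iff by auto
  show "\<exists>V d. {t \<in> S. \<gamma> t \<in> M} \<subseteq> (\<Union>k. V k) \<and> (\<forall>k. 0 \<le> d k) \<and>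
     (\<forall>k::nat. \<forall>s\<in>V k. \<forall>t\<in>V k. \<bar>s - t\<bar> \<le> d k) \<and> (\<Sum>k. ennreal (d k)) \<le> ennreal e"
  proof (intro exI conjI allI ballI)
    show "{t \<in> S. \<gamma> t \<in> M} \<subseteq> (\<Union>k. {t \<in> S. \<gamma> t \<in> U k})" using U by blast
    show "0 \<le> C * diameter (U k)" for k using U \<open>C > 0\<close> by (simp add: diameter_ge_0)
    show "\<bar>s - t\<bar> \<le> C * diameter (U k)"
      if "s \<in> {t \<in> S. \<gamma> t \<in> U k}" "t \<in> {t \<in> S. \<gamma> t \<in> U k}" for k s t
    proof -
      have "dist (\<gamma> s) (\<gamma> t) \<le> diameter (U k)"
        using that U(2) by (intro diameter_bounded_bound) auto
      then have "C * dist (\<gamma> s) (\<gamma> t) \<le> C * diameter (U k)" using \<open>C > 0\<close> by simp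
      then show ?thesis using C[of s t] that by auto
    qed
    have "(\<Sum>k. ennreal (C * diameter (U k))) = ennreal C * (\<Sum>k. ennreal (diameter (U k)))"
      using \<open>C > 0\<close> by (simp add: ennreal_mult')
    also have "\<dots> \<le> ennreal C * ennreal (e / C)" using sum by (intro mult_left_mono) auto
    also have "\<dots> = ennreal e" using \<open>C > 0\<close> by (simp flip: ennreal_mult')
    finally show "(\<Sum>k. ennreal (C * diameter (U k))) \<le> ennreal e" .
  qed
qed

text \<open>The images of \<open>N\<close> equal pieces of a unit interval have total diameter at
  most \<open>L\<close>. Steepness \<open>K\<close> shrinks this to \<open>L / K\<close> for the
  preimages, and \<open>K\<close> is at choice.\<close>

lemma negligible_vimage_lipschitz_image:
  fixes \<gamma> :: "real \<Rightarrow> 'a::metric_space" and F :: "real \<Rightarrow> 'a"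
  assumes steep: "\<And>K. K > 0 \<Longrightarrow> \<exists>\<delta>>0. \<forall>s\<in>S. \<forall>t\<in>S. dist (\<gamma> s) (\<gamma> t) < \<delta> \<longrightarrow>
      K * \<bar>s - t\<bar> \<le> dist (\<gamma> s) (\<gamma> t)"
    and F: "L-lipschitz_on UNIV F"
  shows "negligible {t \<in> S. \<gamma> t \<in> range F}"
proof -
  have L: "L \<ge> 0" using F by (rule lipschitz_on_nonneg)
  have unit: "negligible {t \<in> S. \<gamma> t \<in> F ` {of_int k .. of_int k + 1}}" for k :: int
  proof (rule negligible_if_small_covers)
    fix e :: real assume "e > 0"
    \<comment> \<open>This puts \<open>L / K\<close> below \<open>e\<close>; the added 1 keeps
      \<open>K\<close> positive when \<open>L = 0\<close>.\<close>
    define K where "K = (L + 1) / e"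
    have K: "K > 0" using \<open>e > 0\<close> L by (simp add: K_def)
    obtain \<delta> where \<delta>: "\<delta> > 0" and st: "\<And>s t. s \<in> S \<Longrightarrow> t \<in> S \<Longrightarrow> dist (\<gamma> s) (\<gamma> t) < \<delta> \<Longrightarrow>
      K * \<bar>s - t\<bar> \<le> dist (\<gamma> s) (\<gamma> t)" using steep[OF K] by blast
    \<comment> \<open>So many pieces that the image of each has diameter at most
      \<open>L / N\<close>, below the threshold \<open>\<delta>\<close> for steepness.\<close>
    obtain N :: nat where N: "L / \<delta> < real N" using reals_Archimedean2 by blast
    have N0: "0 < real N" using N L \<delta> by (smt (verit) divide_nonneg_pos)
    have LN: "L / N < \<delta>" using N N0 \<delta> by (simp add: field_simps)
    define V where "V j = (if j < N then
      {t \<in> S. \<gamma> t \<in> F ` {of_int k + real j / N .. of_int k + (real j + 1) / N}} else {})" for j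
    define d where "d j = (if j < N then L / (N * K) else 0)" for j
    show "\<exists>V d. {t \<in> S. \<gamma> t \<in> F ` {of_int k .. of_int k + 1}} \<subseteq> (\<Union>k. V k) \<and> (\<forall>k. 0 \<le> d k) \<and>
     (\<forall>k::nat. \<forall>s\<in>V k. \<forall>t\<in>V k. \<bar>s - t\<bar> \<le> d k) \<and> (\<Sum>k. ennreal (d k)) \<le> ennreal e"
    proof (intro exI conjI allI ballI)
      show "{t \<in> S. \<gamma> t \<in> F ` {of_int k .. of_int k + 1}} \<subseteq> (\<Union>j. V j)"
      proof clarsimp
        fix t x assume t: "t \<in> S" "\<gamma> t = F x" "of_int k \<le> x" "x \<le> of_int k + 1"
        define y where "y = (x - of_int k) * N"
        have y: "0 \<le> y" "y \<le> N" using t N0 by (auto simp: y_def intro: mult_left_le_one_le)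
        have x: "x = of_int k + y / N" using N0 by (simp add: y_def)
        have "\<exists>j<N. real j \<le> y \<and> y \<le> real j + 1"
        \<comment> \<open>At the right end the floor would give the index \<open>N\<close>, one too
          many; that point goes to the last piece.\<close>
        proof (cases "y = N")
          case True
          then show ?thesis using N0 by (intro exI[of _ "N - 1"]) (auto simp: of_nat_diff)
        next
          case False
          then show ?thesis using y by (intro exI[of _ "nat \<lfloor>y\<rfloor>"]) linarith
        qed
        then obtain j where j: "j < N" "real j \<le> y" "y \<le> real j + 1" by blast
        then have "x \<in> {of_int k + real j / N .. of_int k + (real j + 1) / N}"
          unfolding x using N0 by (auto intro: divide_right_mono)
        then have "t \<in> V j" using j t unfolding V_def by auto
        then show "\<exists>j. t \<in> V j" by blast
      qed
      show "0 \<le> d j" for j using L K by (simp add: d_def)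
      show "\<bar>s - t\<bar> \<le> d j" if st': "s \<in> V j" "t \<in> V j" for j s t
      proof -
        have j: "j < N" using st' by (auto simp: V_def split: if_splits)
        obtain x y where xy: "\<gamma> s = F x" "\<gamma> t = F y" "s \<in> S" "t \<in> S"
          "x \<in> {of_int k + real j / N .. of_int k + (real j + 1) / N}"
          "y \<in> {of_int k + real j / N .. of_int k + (real j + 1) / N}"
          using st' j by (auto simp: V_def)
        have "dist x y \<le> 1 / N" using xy by (auto simp: dist_real_def add_divide_distrib)
        then have "L * dist x y \<le> L * (1 / N)" using L by (rule mult_left_mono)
        then have *: "dist (\<gamma> s) (\<gamma> t) \<le> L / N"
          using lipschitz_onD[OF F, of x y] xy by simp
        then have "K * \<bar>s - t\<bar> \<le> L / N" using st[of s t] xy LN by force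
        then show ?thesis using K j N0 by (simp add: d_def field_simps)
      qed
      have "(\<Sum>j. ennreal (d j)) = (\<Sum>j<N. ennreal (d j))"
        by (rule suminf_finite) (auto simp: d_def)
      also have "\<dots> = ennreal (L / K)" 
        using N0 K L by (simp add: d_def ennreal_of_nat_eq_real_of_nat flip: ennreal_mult')
      also have "\<dots> \<le> ennreal e" using K L \<open>e > 0\<close> by (intro ennreal_leI) (simp add: K_def field_simps)
      finally show "(\<Sum>j. ennreal (d j)) \<le> ennreal e" .
    qed
  qed
  have "{t \<in> S. \<gamma> t \<in> range F} \<subseteq> (\<Union>k::int. {t \<in> S. \<gamma> t \<in> F ` {of_int k .. of_int k + 1}})"
  proof clarsimp
    fix t x assume "\<gamma> t = F x"
    moreover have "of_int \<lfloor>x\<rfloor> \<le> x" "x \<le> of_int \<lfloor>x\<rfloor> + 1" by linarith+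
    ultimately show "\<exists>k. F x \<in> F ` {of_int k .. of_int k + 1}" by (metis atLeastAtMost_iff imageI)
  qed
  moreover have "negligible (\<Union>k::int. {t \<in> S. \<gamma> t \<in> F ` {of_int k .. of_int k + 1}})"
    using unit by (intro negligible_countable_Union) auto
  ultimately show ?thesis by (rule negligible_subset[rotated])
qed

lemma closed_segment_subset_lipschitz_image:
  fixes a b :: "'a::real_normed_vector"
  obtains F :: "real \<Rightarrow> 'a" and L where "L-lipschitz_on UNIV F" "closed_segment a b \<subseteq> range F"
proof
  show "(norm (b - a))-lipschitz_on UNIV (\<lambda>t. (1 - t) *\<^sub>R a + t *\<^sub>R b)"
  proof (rule lipschitz_onI)
    fix x y :: real
    have "((1 - x) *\<^sub>R a + x *\<^sub>R b) - ((1 - y) *\<^sub>R a + y *\<^sub>R b) = (x - y) *\<^sub>R (b - a)"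
      by (simp add: algebra_simps)
    then show "dist ((1 - x) *\<^sub>R a + x *\<^sub>R b) ((1 - y) *\<^sub>R a + y *\<^sub>R b) \<le> norm (b - a) * dist x y"
      by (simp add: dist_norm)
  qed simp
  show "closed_segment a b \<subseteq> range (\<lambda>t. (1 - t) *\<^sub>R a + t *\<^sub>R b)"
    by (auto simp: closed_segment_def)
qed

section \<open>The caps of the construction\<close>

locale caps =
  fixes \<epsilon> :: real
  assumes eps_pos: "0 < \<epsilon>" and eps_less: "\<epsilon> < 1 / 100"
begin

text \<open>The m_n of the overview: the edge length at level \<open>n\<close> in units of
  2^-n.\<close>

definition scale :: "nat \<Rightarrow> real" where
  "scale n = sqrt (1 + 16 * \<epsilon>\<^sup>2 * n)"

definition len :: "nat \<Rightarrow> real" where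
  "len n = scale n / 2 ^ n"

text \<open>The cap height 2^(1-n) \<open>\<epsilon>\<close> divided by the edge length, that is,
  the unsigned ratio in \<open>apex\<close>.\<close>

definition slope :: "nat \<Rightarrow> real" where
  "slope n = 2 * \<epsilon> / scale n"

text \<open>The sign alternates by \<open>inner_apex_eq\<close>, starting with the upward cap on the
  initial segment.\<close>

definition sgn_at :: "nat \<Rightarrow> real" where
  "sgn_at n = (-1) ^ n"

lemma sgn_at: "sgn_at n \<in> {1, -1}"
  unfolding sgn_at_def by (cases "even n") auto

lemma sgn_at_Suc: "sgn_at (Suc n) = - sgn_at n"
  by (simp add: sgn_at_def)

lemma scale_ge_1: "1 \<le> scale n"
  by (simp add: scale_def)

lemma scale_mono: "m \<le> n \<Longrightarrow> scale m \<le> scale n"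
  by (simp add: scale_def mult_left_mono)

lemma scale_sq: "(scale n)\<^sup>2 = 1 + 16 * \<epsilon>\<^sup>2 * n"
  by (simp add: scale_def add_nonneg_nonneg)

lemma scale_at_top: "filterlim scale at_top sequentially"
proof -
  have "filterlim (\<lambda>n. 1 + 16 * \<epsilon>\<^sup>2 * real n) at_top sequentially"
    using eps_pos
    by (intro filterlim_tendsto_add_at_top[OF tendsto_const]
        filterlim_tendsto_pos_mult_at_top[OF tendsto_const] filterlim_real_sequentially) simp
  then show ?thesis unfolding scale_def by (rule filterlim_compose[OF sqrt_at_top])
qed

lemma len_pos: "0 < len n"
  using scale_ge_1[of n] by (simp add: len_def)

lemma slope_pos: "0 < slope n"
  using scale_ge_1[of n] eps_pos by (simp add: slope_def)

text \<open>The smallness of \<open>\<epsilon>\<close> enters here; 1/8 is the bound that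
  \<open>dist_children\<close> asks for.\<close>

lemma slope_le: "slope n \<le> 1/8"
proof -
  have "2 * \<epsilon> \<le> (1/8) * 1" using eps_less by simp
  also have "\<dots> \<le> (1/8) * scale n" using scale_ge_1[of n] by simp
  finally show ?thesis using scale_ge_1[of n] by (simp add: slope_def field_simps)
qed

lemma slope_Suc_le: "slope (Suc n) \<le> slope n"
  unfolding slope_def using scale_ge_1[of n] scale_mono[of n "Suc n"] eps_pos
  by (intro divide_left_mono) auto

lemma cap_height_eq: "cap_height \<epsilon> n = slope n * len n"
  using scale_ge_1[of n]
  by (simp add: cap_height_def slope_def len_def power_int_diff)

text \<open>Pythagoras for half the base and the height: passing to the next level adds
  \<open>16 * \<epsilon>\<^sup>2\<close> to the square of \<open>scale\<close>.\<close>

lemma len_Suc: "sqrt (1/4 + (slope n)\<^sup>2) * len n = len (Suc n)"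
proof -
  have "(1/4 + (slope n)\<^sup>2) * (scale n)\<^sup>2 = (scale n)\<^sup>2 / 4 + 4 * \<epsilon>\<^sup>2"
    using scale_ge_1[of n] by (simp add: slope_def field_simps)
  also have "\<dots> = (scale (Suc n))\<^sup>2 / 4"
    by (simp add: scale_sq field_simps)
  finally have "sqrt ((1/4 + (slope n)\<^sup>2) * (scale n)\<^sup>2) = sqrt ((scale (Suc n) / 2)\<^sup>2)"
    by (simp add: power_divide)
  then have "sqrt (1/4 + (slope n)\<^sup>2) * scale n = scale (Suc n) / 2"
    using scale_ge_1[of n] scale_ge_1[of "Suc n"] by (simp add: real_sqrt_mult)
  then show ?thesis by (simp add: len_def field_simps)
qed

lemma len_Suc_le: "len (Suc n) \<le> 3/4 * len n"
proof -
  have "(slope n)\<^sup>2 \<le> (1/8)\<^sup>2" using slope_le[of n] slope_pos[of n] by (intro power_mono) auto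
  then have "sqrt (1/4 + (slope n)\<^sup>2) \<le> sqrt ((3/4)\<^sup>2)"
    by (intro real_sqrt_le_mono) (simp add: power2_eq_square)
  then have "sqrt (1/4 + (slope n)\<^sup>2) * len n \<le> 3/4 * len n"
    using len_pos[of n] by (intro mult_right_mono) auto
  then show ?thesis by (simp only: len_Suc)
qed

lemma len_antimono: "m \<le> n \<Longrightarrow> len n \<le> len m"
proof (induction rule: dec_induct)
  case (step n)
  then show ?case using len_Suc_le[of n] len_pos[of n] by linarith
qed simp

lemma len_tendsto_0: "len \<longlonglongrightarrow> 0"
proof (rule tendsto_sandwich[of "\<lambda>_. 0"])
  show "\<forall>\<^sub>F n in sequentially. len n \<le> (3/4) ^ n"
  proof (intro always_eventually allI)
    show "len n \<le> (3/4) ^ n" for n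
    proof (induction n)
      case (Suc n)
      then show ?case using len_Suc_le[of n] by simp
    qed (simp add: len_def scale_def)
  qed
  show "(\<lambda>n. (3/4) ^ n :: real) \<longlonglongrightarrow> 0" by (rule LIMSEQ_power_zero) simp
  show "\<forall>\<^sub>F n in sequentially. 0 \<le> len n"
    by (intro always_eventually allI less_imp_le[OF len_pos])
qed simp

section \<open>The caps in closed form\<close>

definition lft :: "nat \<Rightarrow> nat \<Rightarrow> real^2" where "lft n i = fst (cap \<epsilon> n i)"
definition rgt :: "nat \<Rightarrow> nat \<Rightarrow> real^2" where "rgt n i = fst (snd (cap \<epsilon> n i))"
definition top_of :: "nat \<Rightarrow> nat \<Rightarrow> real^2" where "top_of n i = snd (snd (cap \<epsilon> n i))"

lemma cap_eq: "cap \<epsilon> n i = (lft n i, rgt n i, top_of n i)"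
  by (simp add: lft_def rgt_def top_of_def)

lemma ends_Suc:
  "lft (Suc n) i = (if odd i then lft n ((i + 1) div 2) else top_of n ((i + 1) div 2))"
  "rgt (Suc n) i = (if odd i then top_of n ((i + 1) div 2) else rgt n ((i + 1) div 2))"
  by (simp_all add: lft_def rgt_def top_of_def split: prod.split)

lemma top_of_Suc:
  "top_of (Suc n) i = inner_apex
     (triangle (lft n ((i + 1) div 2)) (rgt n ((i + 1) div 2)) (top_of n ((i + 1) div 2)))
     (cap_height \<epsilon> (Suc n)) (lft (Suc n) i) (rgt (Suc n) i)"
  by (simp add: lft_def rgt_def top_of_def split: prod.split)

text \<open>Both facts go through one induction: the edge length turns the prescribed height into
  the ratio required by \<open>inner_apex_eq\<close>, and the apex formula yields the next edge
  lengths.\<close>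

lemma cap_shape:
  "norm (rgt n i - lft n i) = len n \<and> top_of n i = apex (sgn_at n * slope n) (lft n i) (rgt n i)"
proof (induction n arbitrary: i)
  case 0
  have "cap_height \<epsilon> 0 = slope 0"
    by (simp add: cap_height_eq len_def scale_def)
  then show ?case
    using first_apex_eq[OF slope_pos[of 0]]
    by (simp add: lft_def rgt_def top_of_def sgn_at_def len_def scale_def
        norm_eq_sqrt_inner inner_vec2 Let_def)
next
  case (Suc n)
  define j where "j = (i + 1) div 2"
  define a where "a = lft n j"
  define b where "b = rgt n j"
  define p where "p = top_of n j"
  have ab: "norm (b - a) = len n" and p: "p = apex (sgn_at n * slope n) a b"
    using Suc.IH[of j] by (auto simp: a_def b_def p_def)
  have ne: "a \<noteq> b" using ab len_pos[of n] by auto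
  have sq: "(sgn_at n * slope n)\<^sup>2 = (slope n)\<^sup>2" using sgn_at[of n] by auto
  have half: "slope n \<le> 1/2" using slope_le[of n] by simp
  note inner = inner_apex_eq[OF slope_pos[of "Suc n"] slope_Suc_le half sgn_at[of n] ne, folded p]
  have top: "top_of (Suc n) i = inner_apex (triangle a b p) (slope (Suc n) * len (Suc n))
      (lft (Suc n) i) (rgt (Suc n) i)"
    by (simp only: top_of_Suc cap_height_eq a_def b_def p_def j_def)
  have norms: "norm (p - a) = len (Suc n)" "norm (b - p) = len (Suc n)"
    unfolding p norm_apex_diff sq ab by (rule len_Suc)+
  show ?case
  proof (cases "odd i")
    case True
    then have "lft (Suc n) i = a" "rgt (Suc n) i = p"
      by (simp_all add: ends_Suc a_def p_def j_def)
    then show ?thesis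
      using norms inner top by (simp add: sgn_at_Suc)
  next
    case False
    then have "lft (Suc n) i = p" "rgt (Suc n) i = b"
      by (simp_all add: ends_Suc b_def p_def j_def)
    then show ?thesis
      using norms inner top by (simp add: sgn_at_Suc)
  qed
qed

lemmas norm_edge = cap_shape[THEN conjunct1]
  and top_of_eq = cap_shape[THEN conjunct2]

lemma lft_neq_rgt: "lft n i \<noteq> rgt n i"
  using norm_edge[of n i] len_pos[of n] by auto

lemma slope_sq: "(sgn_at n * slope n)\<^sup>2 = (slope n)\<^sup>2"
  using sgn_at[of n] by auto

lemma abs_slope_le: "\<bar>sgn_at n * slope n\<bar> \<le> 1/2"
  using sgn_at[of n] slope_le[of n] slope_pos[of n] by auto

definition tri :: "nat \<Rightarrow> nat \<Rightarrow> (real^2) set" where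
  "tri n i = triangle (lft n i) (rgt n i) (top_of n i)"

lemma tri_Suc_odd:
  assumes "odd i"
  shows "tri (Suc n) i = triangle (lft n ((i + 1) div 2)) (top_of n ((i + 1) div 2))
    (apex (- sgn_at n * slope (Suc n)) (lft n ((i + 1) div 2)) (top_of n ((i + 1) div 2)))"
  using assms by (simp add: tri_def top_of_eq[of "Suc n"] ends_Suc sgn_at_Suc)

lemma tri_Suc_even:
  assumes "even i"
  shows "tri (Suc n) i = triangle (top_of n ((i + 1) div 2)) (rgt n ((i + 1) div 2))
    (apex (- sgn_at n * slope (Suc n)) (top_of n ((i + 1) div 2)) (rgt n ((i + 1) div 2)))"
  using assms by (simp add: tri_def top_of_eq[of "Suc n"] ends_Suc sgn_at_Suc)

text \<open>Two vertices of a child are vertices of its parent, and the third is covered by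
  \<open>child_apex_in_triangle\<close>.\<close>

lemma tri_Suc_subset: "tri (Suc n) i \<subseteq> tri n ((i + 1) div 2)"
proof -
  define j where "j = (i + 1) div 2"
  have half: "slope n \<le> 1/2" using slope_le[of n] by simp
  note child = child_apex_in_triangle[OF slope_pos[of "Suc n"] slope_Suc_le half sgn_at[of n],
      of "lft n j" "rgt n j", folded top_of_eq]
  show ?thesis
    unfolding j_def[symmetric] tri_def[of n]
    using child tri_Suc_odd[of i n, folded j_def] tri_Suc_even[of i n, folded j_def]
    by (cases "odd i") (simp_all add: triangle_subset_iff convex_triangle vertices_in_triangle)
qed

section \<open>Base angles and their product\<close>

lemma base_angle_eq: "base_angle \<epsilon> n = arccos (scale n / scale (Suc n))"
proof -
  have "len n / (2 * len (Suc n)) = scale n / scale (Suc n)"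
    by (simp add: len_def)
  moreover have "norm (top_of n i - lft n i) = len (Suc n)" for i
    by (simp add: top_of_eq norm_apex_diff slope_sq norm_edge len_Suc)
  ultimately have *: "vertex_angle (lft n i) (rgt n i) (top_of n i) = arccos (scale n / scale (Suc n))"
    "vertex_angle (rgt n i) (lft n i) (top_of n i) = arccos (scale n / scale (Suc n))" for i
    using vertex_angle_apex[OF lft_neq_rgt, of n i "sgn_at n * slope n"]
    by (simp_all add: norm_edge flip: top_of_eq)
  \<comment> \<open>A nonempty index range is what makes the \<open>THE\<close> in
    \<open>base_angle\<close> unique.\<close>
  have "1 \<in> {1..2 ^ n :: nat}" by simp
  then show ?thesis
    unfolding base_angle_def cap_eq prod.case *
    by (intro the_equality) blast+
qed

lemma prod_inverse_cos: "(\<Prod>n<N. inverse (cos (base_angle \<epsilon> n))) = scale N"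
proof (induction N)
  case (Suc N)
  have "scale N / scale (Suc N) \<le> 1" "0 \<le> scale N / scale (Suc N)" 
    using scale_ge_1[of N] scale_ge_1[of "Suc N"] scale_mono[of N "Suc N"] by auto
  then have "cos (base_angle \<epsilon> N) = scale N / scale (Suc N)"
    by (simp add: base_angle_eq)
  then show ?case using Suc scale_ge_1[of N] by simp
qed (simp add: scale_def)

section \<open>Dyadic addresses of parameters\<close>

text \<open>Caps are numbered from 1, hence the shift; the dyadic intervals are half-open, closed on the left.\<close>

definition idx :: "real \<Rightarrow> nat \<Rightarrow> nat" where
  "idx t n = Suc (nat \<lfloor>2 ^ n * t\<rfloor>)"

lemma idx_bounds:
  assumes "0 \<le> t"
  shows "real (idx t n) - 1 \<le> 2 ^ n * t" "2 ^ n * t < real (idx t n)"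
proof -
  have "0 \<le> \<lfloor>2 ^ n * t\<rfloor>" using assms by simp
  then have "real (nat \<lfloor>2 ^ n * t\<rfloor>) = of_int \<lfloor>2 ^ n * t\<rfloor>" by simp
  then show "real (idx t n) - 1 \<le> 2 ^ n * t" "2 ^ n * t < real (idx t n)"
    unfolding idx_def of_nat_Suc by linarith+
qed

text \<open>Addresses follow the parent relation of \<open>cap\<close>: halving 2x halves its floor,
  and the shift by one is respected since (f + 2) div 2 = f div 2 + 1.\<close>

lemma idx_Suc:
  assumes "0 \<le> t"
  shows "(idx t (Suc n) + 1) div 2 = idx t n"
proof -
  define x where "x = 2 ^ n * t"
  have x: "0 \<le> x" using assms by (simp add: x_def)
  have "\<lfloor>2 * x\<rfloor> div 2 = \<lfloor>x\<rfloor>"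
    by linarith
  then have "nat \<lfloor>2 * x\<rfloor> div 2 = nat \<lfloor>x\<rfloor>"
    using x by (metis nat_div_distrib nat_numeral zero_le_floor mult_nonneg_nonneg zero_le_numeral)
  then show ?thesis by (simp add: idx_def x_def mult.assoc)
qed

lemma idx_0: "0 \<le> t \<Longrightarrow> t < 1 \<Longrightarrow> idx t 0 = 1"
  by (simp add: idx_def floor_eq_iff)

lemma idx_range:
  assumes "0 \<le> t" "t < 1"
  shows "idx t n \<in> {1..2 ^ n}"
proof -
  have "real (idx t n) - 1 < 2 ^ n" using idx_bounds(1)[OF assms(1), of n] assms
    by (smt (verit) mult_less_cancel_left2 zero_less_power)
  then have "real (idx t n) < real (2 ^ n + 1)" by simp
  then have "idx t n < 2 ^ n + 1" by (simp only: of_nat_less_iff)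
  moreover have "1 \<le> idx t n" by (simp add: idx_def)
  ultimately show ?thesis by simp
qed

section \<open>The limit parametrization\<close>

text \<open>The map called \<gamma> in the overview. The estimates below use only that the chosen
  point lies in every cap of the address of \<open>t\<close>.\<close>

definition limit_pt :: "real \<Rightarrow> real^2" where
  "limit_pt t = (SOME x. \<forall>n. x \<in> tri n (idx t n))"

lemma limit_pt_in_tri:
  assumes "0 \<le> t"
  shows "limit_pt t \<in> tri n (idx t n)"
proof -
  have "decseq (\<lambda>n. tri n (idx t n))"
    using tri_Suc_subset idx_Suc[OF assms] by (intro decseq_SucI) metis
  then have "(\<Inter>n. tri n (idx t n)) \<noteq> {}"
    by (intro compact_nest) (auto simp: tri_def compact_triangle decseq_def
        intro: vertices_in_triangle)
  then have "\<exists>x. \<forall>n. x \<in> tri n (idx t n)" by blast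
  from someI_ex[OF this] show ?thesis by (simp add: limit_pt_def)
qed

text \<open>The left endpoint of the level-\<open>n\<close> cap around the point is on the curve, at
  distance at most \<open>len n\<close>.\<close>

lemma limit_pt_in_closure:
  assumes "0 \<le> t" "t < 1"
  shows "limit_pt t \<in> closure (\<Union>n\<in>{1..}. curve \<epsilon> n)"
  unfolding closure_approachable
proof (intro allI impI)
  fix e :: real assume "e > 0"
  then have "\<forall>\<^sub>F n in sequentially. len n < e" by (rule order_tendstoD(2)[OF len_tendsto_0])
  then have "\<forall>\<^sub>F n in sequentially. len n < e \<and> n \<ge> 1"
    using eventually_ge_at_top by (rule eventually_conj)
  then obtain n where n: "len n < e" "n \<ge> 1" by (auto dest: eventually_happens)
  have "lft n (idx t n) \<in> edge \<epsilon> n (idx t n)" by (simp add: edge_def cap_eq)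
  then have "lft n (idx t n) \<in> curve \<epsilon> n" using idx_range[OF assms] unfolding curve_def by blast
  moreover have "dist (limit_pt t) (lft n (idx t n)) \<le> len n"
    using dist_triangle_vertex_le[OF abs_slope_le
        limit_pt_in_tri[OF assms(1), of n, unfolded tri_def top_of_eq]]
    by (simp add: norm_edge)
  ultimately show "\<exists>y\<in>\<Union>n\<in>{1..}. curve \<epsilon> n. dist y (limit_pt t) < e"
    using n by (auto simp: dist_commute intro!: bexI[of _ n] bexI[of _ "lft n (idx t n)"])
qed

section \<open>Separation of points on the limit curve\<close>

lemma slope_le_quarter: "slope n \<le> 1/4"
  using slope_le[of n] by simp

text \<open>As long as the address of \<open>t\<close> takes right children, the right endpoint and
  the parameter gap to it stay the same. At the first left child \<open>dist_left_child\<close>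
  applies, and a gap of at least 2^-n forces this to happen no later than level
  \<open>n\<close>.\<close>

lemma dist_limit_pt_rgt:
  assumes "0 \<le> t" "1 / 2 ^ n \<le> idx t m / 2 ^ m - t"
  shows "len n / 2 \<le> dist (limit_pt t) (rgt m (idx t m))"
  using assms(2)
proof (induction "n - m" arbitrary: m rule: less_induct)
  case less
  \<comment> \<open>The gap never exceeds the length of the dyadic interval, which keeps the level
    at most \<open>n\<close>.\<close>
  have le: "idx t m / 2 ^ m - t \<le> 1 / 2 ^ m" for m
  proof -
    have "idx t m / 2 ^ m \<le> (1 + 2 ^ m * t) / 2 ^ m"
      using idx_bounds(1)[OF assms(1), of m] by (intro divide_right_mono) auto
    then show ?thesis by (simp add: add_divide_distrib)
  qed
  then have "1 / 2 ^ n \<le> (1 / 2 ^ m :: real)" using less.prems le[of m] by linarith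
  then have "(2::real) ^ m \<le> 2 ^ n" by (simp add: field_simps)
  then have mn: "m \<le> n" by simp
  define k where "k = idx t (Suc m)"
  have km: "(k + 1) div 2 = idx t m" using idx_Suc[OF assms(1)] by (simp add: k_def)
  have in_tri: "limit_pt t \<in> tri (Suc m) k"
    using limit_pt_in_tri[OF assms(1)] by (simp add: k_def)
  show ?case
  proof (cases "odd k")
    case True
    then have "limit_pt t \<in> triangle (lft m (idx t m)) (top_of m (idx t m))
        (apex (- sgn_at m * slope (Suc m)) (lft m (idx t m)) (top_of m (idx t m)))"
      using in_tri tri_Suc_odd[of k m] unfolding km by simp
    then have "len m / 2 \<le> dist (limit_pt t) (rgt m (idx t m))"
      using dist_left_child[of "sgn_at m" "slope m" "slope (Suc m)" "limit_pt t"
          "lft m (idx t m)" "rgt m (idx t m)"] sgn_at slope_pos[THEN less_imp_le] slope_le_quarter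
      by (simp add: norm_edge flip: top_of_eq)
    then show ?thesis using len_antimono[OF mn] by simp
  next
    case False
    then have "k = 2 * idx t m" using km by presburger
    then have *: "idx t m / 2 ^ m = k / 2 ^ Suc m" by simp
    have "k / 2 ^ Suc m - t \<le> 1 / 2 ^ Suc m"
      using le[of "Suc m"] by (simp add: k_def)
    then have "1 / 2 ^ n \<le> (1 / 2 ^ Suc m :: real)" using less.prems * by linarith
    then have "(2::real) ^ Suc m \<le> 2 ^ n" by (simp add: field_simps)
    then have "Suc m \<le> n" by (simp only: power_increasing_iff)
    then have "len n / 2 \<le> dist (limit_pt t) (rgt (Suc m) k)"
      using less.hyps[of "Suc m"] less.prems * by (simp add: k_def)
    then show ?thesis using False km by (simp add: ends_Suc)
  qed
qed

lemma dist_limit_pt_lft: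
  assumes "0 \<le> t" "1 / 2 ^ n \<le> t - (real (idx t m) - 1) / 2 ^ m"
  shows "len n / 2 \<le> dist (limit_pt t) (lft m (idx t m))"
  using assms(2)
proof (induction "n - m" arbitrary: m rule: less_induct)
  case less
  \<comment> \<open>Strict, unlike for the right endpoint, since the dyadic intervals are open on
    the right. This gives \<open>m < n\<close> at once, so \<open>n - m\<close> decreases in the
    recursive case.\<close>
  have lt: "t - (real (idx t m) - 1) / 2 ^ m < 1 / 2 ^ m" for m
    using idx_bounds(2)[OF assms(1), of m] by (simp add: field_simps)
  then have "1 / 2 ^ n < (1 / 2 ^ m :: real)" using less.prems by (meson le_less_trans)
  then have "(2::real) ^ m < 2 ^ n" by (simp add: field_simps)
  then have mn: "m < n" by simp
  define k where "k = idx t (Suc m)"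
  have km: "(k + 1) div 2 = idx t m" using idx_Suc[OF assms(1)] by (simp add: k_def)
  have in_tri: "limit_pt t \<in> tri (Suc m) k"
    using limit_pt_in_tri[OF assms(1)] by (simp add: k_def)
  show ?case
  proof (cases "odd k")
    case False
    then have "limit_pt t \<in> triangle (top_of m (idx t m)) (rgt m (idx t m))
        (apex (- sgn_at m * slope (Suc m)) (top_of m (idx t m)) (rgt m (idx t m)))"
      using in_tri tri_Suc_even[of k m] unfolding km by simp
    then have "len m / 2 \<le> dist (limit_pt t) (lft m (idx t m))"
      using dist_right_child[of "sgn_at m" "slope m" "slope (Suc m)" "limit_pt t"
          "lft m (idx t m)" "rgt m (idx t m)"] sgn_at slope_pos[THEN less_imp_le] slope_le_quarter
      by (simp add: norm_edge flip: top_of_eq)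
    then show ?thesis using len_antimono[of m n] mn by simp
  next
    case True
    then have "k + 1 = 2 * idx t m" using km by presburger
    then have "real k + 1 = 2 * real (idx t m)" by linarith
    then have "real k - 1 = 2 * (real (idx t m) - 1)" by simp
    then have *: "(real (idx t m) - 1) / 2 ^ m = (real k - 1) / 2 ^ Suc m"
      by (simp only: power_Suc)
    then have "len n / 2 \<le> dist (limit_pt t) (lft (Suc m) k)"
      using less.hyps[of "Suc m"] less.prems mn by (simp add: k_def)
    then show ?thesis using True km by (simp add: ends_Suc)
  qed
qed

text \<open>Take a level where the two addresses part: \<open>s\<close> goes to the left child,
  \<open>t\<close> to the right one. By the obtuse angle at the common vertex \<open>p\<close>, each
  point's distance to \<open>p\<close> bounds the distance between them from below.\<close>

lemma dist_limit_pt_ge_aux: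
  assumes "0 \<le> s" "s < t" "t < 1" "2 / 2 ^ n \<le> t - s"
  shows "len n / 2 \<le> dist (limit_pt s) (limit_pt t)"
proof -
  have t: "0 \<le> t" using assms by simp
  have "2 \<le> 2 ^ n * t - 2 ^ n * s" using assms(4) by (simp add: field_simps)
  then have "idx s n \<noteq> idx t n"
    using idx_bounds[OF assms(1), of n] idx_bounds[OF t, of n] by auto
  moreover have "idx s 0 = idx t 0" using assms by (simp add: idx_0)
  ultimately obtain k where k: "idx s k = idx t k" "idx s (Suc k) \<noteq> idx t (Suc k)"
    by (induction n) auto
  define j where "j = idx s k"
  have j: "(idx s (Suc k) + 1) div 2 = j" "(idx t (Suc k) + 1) div 2 = j"
    using idx_Suc[OF assms(1), of k] idx_Suc[OF t, of k] k by (auto simp: j_def)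
  have "2 ^ Suc k * s \<le> 2 ^ Suc k * t" using assms by simp
  then have "real (idx s (Suc k)) < real (idx t (Suc k)) + 1"
    using idx_bounds[OF assms(1), of "Suc k"] idx_bounds[OF t, of "Suc k"] by linarith
  then have "idx s (Suc k) < idx t (Suc k)" using k by linarith
  then have st: "idx s (Suc k) + 1 = 2 * j" "idx t (Suc k) = 2 * j" using j by presburger+
  define p where "p = top_of k j"
  have in_tri: "limit_pt s \<in> tri (Suc k) (idx s (Suc k))" "limit_pt t \<in> tri (Suc k) (idx t (Suc k))"
    using limit_pt_in_tri assms t by auto
  have odd: "odd (idx s (Suc k))" "even (idx t (Suc k))" using st by presburger+
  have dist: "dist (limit_pt s) p \<le> dist (limit_pt s) (limit_pt t)"
    "dist (limit_pt t) p \<le> dist (limit_pt s) (limit_pt t)"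
    using in_tri odd dist_children[of "sgn_at k" "slope k" "slope (Suc k)" "limit_pt s"
        "lft k j" "rgt k j" "limit_pt t"] sgn_at slope_pos[THEN less_imp_le] slope_le j
    by (simp_all add: p_def tri_Suc_odd tri_Suc_even flip: top_of_eq)
  have p: "rgt (Suc k) (idx s (Suc k)) = p" "lft (Suc k) (idx t (Suc k)) = p"
    using odd j by (simp_all add: ends_Suc p_def)
  have eq: "real (idx s (Suc k)) = real (idx t (Suc k)) - 1" using st by linarith
  \<comment> \<open>The dyadic parameter of \<open>p\<close> splits the interval from
    \<open>s\<close> to \<open>t\<close>, so one of the two parts has at least half its
    length.\<close>
  then consider "1 / 2 ^ n \<le> idx s (Suc k) / 2 ^ Suc k - s"
    | "1 / 2 ^ n \<le> t - (real (idx t (Suc k)) - 1) / 2 ^ Suc k"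
    using assms(4) by fastforce
  then show ?thesis
  proof cases
    case 1
    then show ?thesis using dist_limit_pt_rgt[OF assms(1) 1] p dist by simp
  next
    case 2
    then show ?thesis using dist_limit_pt_lft[OF t 2] p dist by simp
  qed
qed

lemma dist_limit_pt_ge:
  assumes "s \<in> {0..<1}" "t \<in> {0..<1}" "2 / 2 ^ n \<le> \<bar>s - t\<bar>"
  shows "len n / 2 \<le> dist (limit_pt s) (limit_pt t)"
proof -
  have "0 < \<bar>s - t\<bar>" using assms(3) by (smt (verit) divide_pos_pos zero_less_power)
  then consider "s < t" | "t < s" by linarith
  then show ?thesis
    using dist_limit_pt_ge_aux[of s t n] dist_limit_pt_ge_aux[of t s n] assms
    by cases (auto simp: dist_commute)
qed

text \<open>At a level where 2 / 2^n first drops to \<open>\<bar>s - t\<bar>\<close> or below, the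
  parameter distance is at most 4 / 2^n; with the half in \<open>dist_limit_pt_ge\<close> this gives
  the constant 8. The first bound serves to show that close points have large
  \<open>n\<close>.\<close>

lemma limit_pt_steep_at_scale:
  assumes "s \<in> {0..<1}" "t \<in> {0..<1}" "s \<noteq> t"
  obtains n where "len n / 2 \<le> dist (limit_pt s) (limit_pt t)"
    "scale n / 8 * \<bar>s - t\<bar> \<le> dist (limit_pt s) (limit_pt t)"
proof -
  let ?P = "\<lambda>n. 2 / 2 ^ n \<le> \<bar>s - t\<bar>"
  obtain N where "(1/2) ^ N < \<bar>s - t\<bar> / 2"
    using real_arch_pow_inv[of "\<bar>s - t\<bar> / 2" "1/2"] assms by auto
  then have "?P N" by (simp add: power_divide)
  \<comment> \<open>\<open>?P 0\<close> would put two parameters from [0,1) at distance at least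
    2.\<close>
  moreover have "\<not> ?P 0" using assms by auto
  ultimately obtain n where n: "\<not> ?P n" "?P (Suc n)"
    by (induction N) auto
  have d: "len (Suc n) / 2 \<le> dist (limit_pt s) (limit_pt t)"
    using dist_limit_pt_ge[OF assms(1,2) n(2)] .
  have "\<bar>s - t\<bar> \<le> 4 / 2 ^ Suc n" using n(1) by simp
  then have "scale (Suc n) / 8 * \<bar>s - t\<bar> \<le> scale (Suc n) / 8 * (4 / 2 ^ Suc n)"
    using scale_ge_1[of "Suc n"] by (intro mult_left_mono) auto
  also have "\<dots> = len (Suc n) / 2" by (simp add: len_def)
  finally show ?thesis using that[OF d] d by linarith
qed

lemma limit_pt_expanding:
  assumes "s \<in> {0..<1}" "t \<in> {0..<1}"
  shows "\<bar>s - t\<bar> \<le> 8 * dist (limit_pt s) (limit_pt t)"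
proof (cases "s = t")
  case False
  then obtain n where n: "scale n / 8 * \<bar>s - t\<bar> \<le> dist (limit_pt s) (limit_pt t)"
    using limit_pt_steep_at_scale[OF assms] by blast
  have "1 * \<bar>s - t\<bar> \<le> scale n * \<bar>s - t\<bar>" by (intro mult_right_mono scale_ge_1) auto
  then show ?thesis using n by simp
qed simp

text \<open>Edge lengths decrease, so points closer than \<open>len N / 2\<close> are compared at a
  level \<open>n \<ge> N\<close>, where \<open>scale n / 8\<close> is already at least
  \<open>K\<close>.\<close>

lemma limit_pt_steep:
  assumes "K > 0"
  shows "\<exists>\<delta>>0. \<forall>s\<in>{0..<1}. \<forall>t\<in>{0..<1}. dist (limit_pt s) (limit_pt t) < \<delta> \<longrightarrow>
    K * \<bar>s - t\<bar> \<le> dist (limit_pt s) (limit_pt t)"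
proof -
  have "\<forall>\<^sub>F n in sequentially. 8 * K \<le> scale n"
    using scale_at_top by (simp add: filterlim_at_top)
  then obtain N where N: "8 * K \<le> scale N" by (auto dest: eventually_happens)
  show ?thesis
  proof (intro exI conjI ballI impI)
    show "0 < len N / 2" using len_pos by simp
    fix s t :: real
    assume st: "s \<in> {0..<1}" "t \<in> {0..<1}" and d: "dist (limit_pt s) (limit_pt t) < len N / 2"
    show "K * \<bar>s - t\<bar> \<le> dist (limit_pt s) (limit_pt t)"
    proof (cases "s = t")
      case False
      then obtain n where n: "len n / 2 \<le> dist (limit_pt s) (limit_pt t)"
        "scale n / 8 * \<bar>s - t\<bar> \<le> dist (limit_pt s) (limit_pt t)"
        using limit_pt_steep_at_scale[OF st] by blast
      then have "len n < len N" using d by linarith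
      then have "N \<le> n" using len_antimono[of n N] by linarith
      then have "K \<le> scale n / 8" using N scale_mono[of N n] by linarith
      then have "K * \<bar>s - t\<bar> \<le> scale n / 8 * \<bar>s - t\<bar>" by (intro mult_right_mono) auto
      then show ?thesis using n by linarith
    qed simp
  qed
qed

section \<open>Non-rectifiability of the limit set\<close>

lemma not_rectifiable: "\<not> countably_1_rectifiable (A_set \<epsilon>)"
proof
  assume "countably_1_rectifiable (A_set \<epsilon>)"
  then obtain M0 and F :: "nat \<Rightarrow> real \<Rightarrow> real^2" where M0: "hausdorff1 M0 = 0"
    and F: "\<And>j. \<exists>L. L-lipschitz_on UNIV (F j)" and A: "A_set \<epsilon> \<subseteq> M0 \<union> (\<Union>j. range (F j))"
    unfolding countably_1_rectifiable_def by blast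
  let ?S = "{0..<1::real}"
  have 1: "negligible {t \<in> ?S. limit_pt t \<in> M0}"
    by (rule negligible_vimage_hausdorff1_null[OF M0, of _ 8]) (use limit_pt_expanding in auto)
  have lip: "negligible {t \<in> ?S. limit_pt t \<in> range G}" if "L-lipschitz_on UNIV G" for L and G :: "real \<Rightarrow> real^2"
    by (rule negligible_vimage_lipschitz_image, erule limit_pt_steep, rule that)
  have "negligible {t \<in> ?S. limit_pt t \<in> range (F j)}" for j
  proof -
    obtain L where "L-lipschitz_on UNIV (F j)" using F by blast
    then show ?thesis by (rule lip)
  qed
  then have 2: "negligible (\<Union>j. {t \<in> ?S. limit_pt t \<in> range (F j)})"
    by (intro negligible_countable_Union) auto
  have seg: "negligible {t \<in> ?S. limit_pt t \<in> edge \<epsilon> n i}" for n i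
  proof -
    obtain G :: "real \<Rightarrow> real^2" and L where G: "L-lipschitz_on UNIV G"
      "closed_segment (lft n i) (rgt n i) \<subseteq> range G"
      by (rule closed_segment_subset_lipschitz_image)
    have "{t \<in> ?S. limit_pt t \<in> edge \<epsilon> n i} \<subseteq> {t \<in> ?S. limit_pt t \<in> range G}"
      using G(2) by (auto simp: edge_def cap_eq)
    then show ?thesis by (rule negligible_subset[OF lip[OF G(1)]])
  qed
  have "negligible (\<Union>i. {t \<in> ?S. limit_pt t \<in> edge \<epsilon> n i})" for n
    using seg by (intro negligible_countable_Union) auto
  \<comment> \<open>The union runs over all pairs of naturals, including indices beyond
    \<open>2 ^ n\<close>; being countable is all that matters.\<close>
  then have 3: "negligible (\<Union>n. \<Union>i. {t \<in> ?S. limit_pt t \<in> edge \<epsilon> n i})"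
    by (intro negligible_countable_Union) auto
  have "?S \<subseteq> {t \<in> ?S. limit_pt t \<in> M0} \<union> (\<Union>j. {t \<in> ?S. limit_pt t \<in> range (F j)})
      \<union> (\<Union>n. \<Union>i. {t \<in> ?S. limit_pt t \<in> edge \<epsilon> n i})"
  proof
    fix t assume t: "t \<in> ?S"
    then have "limit_pt t \<in> A_set \<epsilon> \<or> (\<exists>n. limit_pt t \<in> curve \<epsilon> n)"
      using limit_pt_in_closure[of t] unfolding A_set_def by auto
    then show "t \<in> {t \<in> ?S. limit_pt t \<in> M0} \<union> (\<Union>j. {t \<in> ?S. limit_pt t \<in> range (F j)})
      \<union> (\<Union>n. \<Union>i. {t \<in> ?S. limit_pt t \<in> edge \<epsilon> n i})"
    proof
      assume "limit_pt t \<in> A_set \<epsilon>"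
      then have "limit_pt t \<in> M0 \<or> (\<exists>j. limit_pt t \<in> range (F j))" using A by blast
      then show ?thesis using t by auto
    next
      assume "\<exists>n. limit_pt t \<in> curve \<epsilon> n"
      then obtain n i where "limit_pt t \<in> edge \<epsilon> n i" unfolding curve_def by blast
      then show ?thesis using t by auto
    qed
  qed
  then have "negligible ?S"
    by (rule negligible_subset[rotated]) (intro negligible_Un 1 2 3)
  then have "negligible (box 0 (1::real))" by (rule negligible_subset) auto
  then show False using negligible_interval(2)[of 0 "1::real"] by simp
qed

end

theorem theorem8p5:
  fixes \<epsilon> :: real
  assumes "0 < \<epsilon>" and "\<epsilon> < 1 / 100"
  shows "(\<forall>x. Pi_tilde \<epsilon> x = \<infinity>) \<and>
         filterlim (\<lambda>N. \<Prod>n<N. inverse (cos (base_angle \<epsilon> n))) at_top sequentially \<and>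
         \<not> countably_1_rectifiable (A_set \<epsilon>)"
proof -
  interpret caps \<epsilon> using assms by unfold_locales
  \<comment> \<open>The partial products equal \<open>scale N\<close>, so this convergence in the
    extended reals determines the \<open>lim\<close> in \<open>Pi_tilde\<close>.\<close>
  have "(\<lambda>N. ereal (scale N)) \<longlonglongrightarrow> \<infinity>"
    using scale_at_top by (simp add: tendsto_PInfty_eq_at_top)
  then have "Pi_tilde \<epsilon> x = \<infinity>" for x
    by (simp add: Pi_tilde_def prod_inverse_cos limI)
  then show ?thesis using scale_at_top not_rectifiable by (simp add: prod_inverse_cos)
qed

end
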